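(* Let $\Gamma<\mathrm{PSL}(2,\mathbb{R})$ be a torsion-free Fuchsian (discrete) group, $S=\Gamma\backslash\mathbb{H}^2$, and $u\in T^1S$. Then $$W^{ss}_{d_1}(u)=W^{ss}_{d_2}(u).$$
   Context: $d$ is the hyperbolic distance on the upper half-plane $\mathbb{H}^2$; for $\tilde v\in T^1\mathbb{H}^2$, $\tilde v(t)$ is the point at time $t$ of the unit-speed geodesic determined by $\tilde v$; $(g_t)$ is the geodesic flow on $T^1\mathbb{H}^2$ and on $T^1S=\Gamma\backslash T^1\mathbb{H}^2$. The distance $d_1$ on $T^1\mathbb{H}^2$ is defined by $$d_1(\tilde v,\tilde w)=d(\tilde v(0),\tilde w(0))+d(\tilde v(1),\tilde w(1)).$$ Let $\tilde v,\tilde w\in T^1\mathbb{H}^2$ be such that $\tilde v(0)\ne\tilde w(0)$. Let $C_{\tilde v,\tilde w}\in T^1\mathbb{H}^2$ be the unit tangent vector at $\tilde v(0)$ of the geodesic ray starting at $\tilde v(0)$ and passing through $\tilde w(0)$. For $s=d(\tilde v(0),\tilde w(0))$, the base point of $g_sC_{\tilde v,\tilde w}$ is $\tilde w(0)$. Let $\alpha_{\tilde v,\tilde w}\in[0,2\pi)$ (resp. $\beta_{\tilde v,\tilde w}\in[0,2\pi)$) be the oriented angle from $C_{\tilde v,\tilde w}$ to $\tilde v$ (resp. from $g_sC_{\tilde v,\tilde w}$ to $\tilde w$). The distance $d_2:T^1\mathbb{H}^2\times T^1\mathbb{H}^2\to\mathbb{R}_+$ is defined by $$d_2(\tilde v,\tilde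 w)=d(\tilde v(0),\tilde w(0))+|\alpha_{\tilde v,\tilde w}-\beta_{\tilde v,\tilde w}|.$$ Both $d_1$ and $d_2$ are invariant under $\mathrm{PSL}(2,\mathbb{R})$ and induce distances on $T^1S$, again denoted $d_1$ and $d_2$: for $i=1,2$ and $u,v\in T^1S$, $$d_i(u,v)=\inf_{\gamma\in\Gamma}d_i(\tilde u,\gamma\tilde v),$$ where $\tilde u,\tilde v\in T^1\mathbb{H}^2$ project onto $u,v$. For $i=1,2$, $$W^{ss}_{d_i}(u)=\{v\in T^1S : \lim_{t\to+\infty}d_i(g_tu,g_tv)=0\}.$$
   Formalization: In d_2, |α−β| is taken modulo 2π, i.e. min(|α−β|, 2π−|α−β|), since the literal formula is not symmetric and so not a distance; when v(0)=w(0), where d_2 is left undefined, C_{v,w} is taken to be v. *)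

theory Defs
  imports "HOL-Analysis.Analysis" "HOL-Algebra.Coset"
begin

section \<open>The upper half-plane and its unit tangent bundle\<close>

definition upper_half_plane :: "complex set" where
  "upper_half_plane = {z. 0 < Im z}"

definition hdist :: "complex \<Rightarrow> complex \<Rightarrow> real" where
  "hdist z w = arcosh (1 + (cmod (z - w))\<^sup>2 / (2 * Im z * Im w))"

text \<open>A tangent vector is a pair (base point, vector); the hyperbolic length of
  \<open>\<xi>\<close> at \<open>z\<close> is \<open>cmod \<xi> / Im z\<close>.\<close>

definition T1H :: "(complex \<times> complex) set" where
  "T1H = {(z, \<xi>). z \<in> upper_half_plane \<and> cmod \<xi> = Im z}"

text \<open>The map \<open>\<omega> \<mapsto> (z - cnj z * \<omega>) / (1 - \<omega>)\<close> is the isometry from the Poincare disc to the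
  half-plane that sends \<open>0\<close> to \<open>z\<close> and has derivative \<open>2 * \<i> * Im z\<close> at \<open>0\<close>. The geodesic with
  initial vector \<open>(z, \<xi>)\<close> is the image of the diameter \<open>t \<mapsto> tanh (t/2) * \<xi> / (\<i> * Im z)\<close>;
  the second component of the flow is its velocity. This is verified in the lemmas
  \<open>hdist_geodesic\<close>, \<open>geodesic_0\<close> and \<open>geodesic_has_vector_derivative\<close> below.\<close>

definition geodesic_flow :: "real \<Rightarrow> complex \<times> complex \<Rightarrow> complex \<times> complex" where
  "geodesic_flow t v =
     (let z = fst v; \<xi> = snd v; \<tau> = tanh (t / 2);
          \<omega> = of_real \<tau> * (\<xi> / (\<i> * of_real (Im z)))
      in ((z - cnj z * \<omega>) / (1 - \<omega>), \<xi> * of_real (1 - \<tau>\<^sup>2) / (1 - \<omega>)\<^sup>2))"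

definition geodesic :: "complex \<times> complex \<Rightarrow> real \<Rightarrow> complex" where
  "geodesic v t = fst (geodesic_flow t v)"


section \<open>The distances on the unit tangent bundle\<close>

definition d1 :: "complex \<times> complex \<Rightarrow> complex \<times> complex \<Rightarrow> real" where
  "d1 v w = hdist (geodesic v 0) (geodesic w 0) + hdist (geodesic v 1) (geodesic w 1)"

text \<open>If \<open>v\<close> and \<open>w\<close> have the same base point, every unit vector there is a possible choice of
  connecting direction, and all choices give the same value of \<open>d2\<close>; we take \<open>v\<close> itself.\<close>

definition connecting_vector :: "complex \<times> complex \<Rightarrow> complex \<times> complex \<Rightarrow> complex \<times> complex" where
  "connecting_vector v w =
     (if geodesic v 0 = geodesic w 0 then v
      else (THE c. c \<in> T1H \<and> geodesic c 0 = geodesic v 0 \<and>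
                   geodesic c (hdist (geodesic v 0) (geodesic w 0)) = geodesic w 0))"

text \<open>The half-plane model is conformal, so the oriented angle between vectors with the same base
  point is the Euclidean one; \<open>Arg2pi\<close> takes its values in \<open>[0, 2\<pi>)\<close>.\<close>

definition oriented_angle :: "complex \<times> complex \<Rightarrow> complex \<times> complex \<Rightarrow> real" where
  "oriented_angle a b = Arg2pi (snd b / snd a)"

text \<open>Angles are elements of \<open>\<real> / 2\<pi>\<int>\<close>; for representatives in \<open>[0, 2\<pi>)\<close> this is their distance
  on that circle. With the plain absolute value of the difference of the representatives, \<open>d2\<close>
  would be neither symmetric nor continuous (vectors with angles close to \<open>0\<close> and to
  \<open>2\<pi>\<close> would be far apart).\<close>

definition angle_diff :: "real \<Rightarrow> real \<Rightarrow> real" where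
  "angle_diff \<alpha> \<beta> = min \<bar>\<alpha> - \<beta>\<bar> (2 * pi - \<bar>\<alpha> - \<beta>\<bar>)"

definition d2 :: "complex \<times> complex \<Rightarrow> complex \<times> complex \<Rightarrow> real" where
  "d2 v w =
     (let s = hdist (geodesic v 0) (geodesic w 0);
          c = connecting_vector v w;
          \<alpha> = oriented_angle c v;
          \<beta> = oriented_angle (geodesic_flow s c) w
      in s + angle_diff \<alpha> \<beta>)"


section \<open>PSL(2,R) and Fuchsian groups\<close>

definition SL2R :: "(real ^ 2 ^ 2) monoid" where
  "SL2R = \<lparr>carrier = {A. det A = 1}, mult = (**), one = mat 1\<rparr>"

definition PSL2R :: "(real ^ 2 ^ 2) set monoid" where
  "PSL2R = SL2R Mod {mat 1, - mat 1}"

text \<open>The action on tangent vectors is by the Moebius transformation on the base point and by its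
  derivative on the vector.\<close>

definition SL2R_act :: "real ^ 2 ^ 2 \<Rightarrow> complex \<times> complex \<Rightarrow> complex \<times> complex" where
  "SL2R_act A v =
     (let z = fst v; \<xi> = snd v;
          den = of_real (A $ 2 $ 1) * z + of_real (A $ 2 $ 2)
      in ((of_real (A $ 1 $ 1) * z + of_real (A $ 1 $ 2)) / den, \<xi> / den\<^sup>2))"

definition PSL2R_act :: "(real ^ 2 ^ 2) set \<Rightarrow> complex \<times> complex \<Rightarrow> complex \<times> complex" where
  "PSL2R_act \<gamma> v = SL2R_act (SOME A. A \<in> \<gamma>) v"

text \<open>\<open>\<Union>\<Gamma>\<close> is the preimage of \<open>\<Gamma>\<close> in \<open>SL(2,R)\<close>. As \<open>SL(2,R) \<rightarrow> PSL(2,R)\<close> is a two-sheeted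
  covering, \<open>\<Gamma>\<close> is discrete in \<open>PSL(2,R)\<close> iff \<open>\<Union>\<Gamma>\<close> is discrete as a set of matrices.\<close>

definition fuchsian :: "(real ^ 2 ^ 2) set set \<Rightarrow> bool" where
  "fuchsian \<Gamma> \<longleftrightarrow> subgroup \<Gamma> PSL2R \<and> discrete (\<Union>\<Gamma>)"

definition torsion_free :: "(real ^ 2 ^ 2) set set \<Rightarrow> bool" where
  "torsion_free \<Gamma> \<longleftrightarrow>
     (\<forall>\<gamma>\<in>\<Gamma>. \<forall>n::nat. 0 < n \<and> \<gamma> [^]\<^bsub>PSL2R\<^esub> n = \<one>\<^bsub>PSL2R\<^esub> \<longrightarrow> \<gamma> = \<one>\<^bsub>PSL2R\<^esub>)"


section \<open>The quotient and strong stable sets\<close>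

definition orbit :: "(real ^ 2 ^ 2) set set \<Rightarrow> complex \<times> complex \<Rightarrow> (complex \<times> complex) set" where
  "orbit \<Gamma> v = (\<lambda>\<gamma>. PSL2R_act \<gamma> v) ` \<Gamma>"

definition T1S :: "(real ^ 2 ^ 2) set set \<Rightarrow> (complex \<times> complex) set set" where
  "T1S \<Gamma> = orbit \<Gamma> ` T1H"

definition flow_quot :: "real \<Rightarrow> (complex \<times> complex) set \<Rightarrow> (complex \<times> complex) set" where
  "flow_quot t u = geodesic_flow t ` u"

text \<open>As \<open>d1\<close> and \<open>d2\<close> are invariant under \<open>PSL(2,R)\<close>, the infimum does not depend on the
  lifts chosen by \<open>SOME\<close>.\<close>

definition dist_quot ::
  "(real ^ 2 ^ 2) set set \<Rightarrow> (complex \<times> complex \<Rightarrow> complex \<times> complex \<Rightarrow> real) \<Rightarrow>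
   (complex \<times> complex) set \<Rightarrow> (complex \<times> complex) set \<Rightarrow> real" where
  "dist_quot \<Gamma> d u v = (INF \<gamma>\<in>\<Gamma>. d (SOME v'. v' \<in> u) (PSL2R_act \<gamma> (SOME v'. v' \<in> v)))"

definition Wss ::
  "(real ^ 2 ^ 2) set set \<Rightarrow> (complex \<times> complex \<Rightarrow> complex \<times> complex \<Rightarrow> real) \<Rightarrow>
   (complex \<times> complex) set \<Rightarrow> (complex \<times> complex) set set" where
  "Wss \<Gamma> d u =
     {v \<in> T1S \<Gamma>. ((\<lambda>t::real. dist_quot \<Gamma> d (flow_quot t u) (flow_quot t v)) \<longlongrightarrow> 0) at_top}"


section \<open>Correctness of the explicit formulas\<close>

lemma geodesic_flow_0: "geodesic_flow 0 v = v"
  by (simp add: geodesic_flow_def Let_def)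

lemma geodesic_0: "geodesic v 0 = fst v"
  by (simp add: geodesic_def geodesic_flow_0)

definition disc_map :: "complex \<Rightarrow> complex \<Rightarrow> complex" where
  "disc_map z \<omega> = (z - cnj z * \<omega>) / (1 - \<omega>)"

lemma Im_disc_map:
  assumes "cmod \<omega> < 1"
  shows "Im (disc_map z \<omega>) = Im z * (1 - (cmod \<omega>)\<^sup>2) / (cmod (1 - \<omega>))\<^sup>2"
proof -
  have "Im ((z - cnj z * \<omega>) * cnj (1 - \<omega>)) = Im z * (1 - (cmod \<omega>)\<^sup>2)"
    unfolding cmod_power2 by (simp add: algebra_simps power2_eq_square)
  moreover have "disc_map z \<omega> = (z - cnj z * \<omega>) * cnj (1 - \<omega>) / of_real ((cmod (1 - \<omega>))\<^sup>2)"
    unfolding disc_map_def by (subst complex_div_cnj) simp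
  ultimately show ?thesis
    by (simp only: Im_divide_of_real)
qed

lemma disc_map_diff:
  assumes "cmod \<omega> < 1" "cmod \<omega>' < 1"
  shows "disc_map z \<omega> - disc_map z \<omega>' = (z - cnj z) * (\<omega> - \<omega>') / ((1 - \<omega>) * (1 - \<omega>'))"
proof -
  have "1 - \<omega> \<noteq> 0" "1 - \<omega>' \<noteq> 0" using assms by auto
  then show ?thesis
    unfolding disc_map_def by (simp add: divide_simps) (simp add: algebra_simps)
qed

lemma hdist_disc_map:
  assumes "0 < Im z" "cmod \<omega> < 1" "cmod \<omega>' < 1"
  shows "hdist (disc_map z \<omega>) (disc_map z \<omega>') =
    arcosh (1 + 2 * (cmod (\<omega> - \<omega>'))\<^sup>2 / ((1 - (cmod \<omega>)\<^sup>2) * (1 - (cmod \<omega>')\<^sup>2)))"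
proof -
  have n: "cmod (1 - \<omega>) \<noteq> 0" "cmod (1 - \<omega>') \<noteq> 0" using assms by auto
  have lt: "(cmod \<omega>)\<^sup>2 < 1" "(cmod \<omega>')\<^sup>2 < 1"
    using assms by (simp_all add: abs_square_less_1)
  have z: "cmod (z - cnj z) = 2 * Im z"
    using assms(1) by (simp add: complex_diff_cnj norm_mult)
  have "(cmod (disc_map z \<omega> - disc_map z \<omega>'))\<^sup>2 =
      4 * (Im z)\<^sup>2 * (cmod (\<omega> - \<omega>'))\<^sup>2 / ((cmod (1 - \<omega>))\<^sup>2 * (cmod (1 - \<omega>'))\<^sup>2)"
    unfolding disc_map_diff[OF assms(2,3)] norm_divide norm_mult z
    by (simp add: power_divide power_mult_distrib)
  then have "(cmod (disc_map z \<omega> - disc_map z \<omega>'))\<^sup>2 / (2 * Im (disc_map z \<omega>) * Im (disc_map z \<omega>')) =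
      2 * (cmod (\<omega> - \<omega>'))\<^sup>2 / ((1 - (cmod \<omega>)\<^sup>2) * (1 - (cmod \<omega>')\<^sup>2))"
    unfolding Im_disc_map[OF assms(2)] Im_disc_map[OF assms(3)]
    using assms(1) n lt by (simp add: divide_simps) (simp add: algebra_simps power2_eq_square)
  then show ?thesis unfolding hdist_def by simp
qed

lemma geodesic_disc_map:
  "geodesic v t = disc_map (fst v) (of_real (tanh (t / 2)) * (snd v / (\<i> * of_real (Im (fst v)))))"
  by (simp add: geodesic_def geodesic_flow_def disc_map_def Let_def)

lemma abs_tanh_less_1: "\<bar>tanh (x::real)\<bar> < 1"
  using tanh_real_bounds[of x] by auto

lemma T1H_direction:
  assumes "v \<in> T1H"
  shows "0 < Im (fst v)" "cmod (snd v / (\<i> * of_real (Im (fst v)))) = 1"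
  using assms by (auto simp: T1H_def upper_half_plane_def norm_divide norm_mult)

lemma tanh_half_sinh:
  fixes s t :: real
  shows "1 + 2 * (tanh (s / 2) - tanh (t / 2))\<^sup>2 /
    ((1 - (tanh (s / 2))\<^sup>2) * (1 - (tanh (t / 2))\<^sup>2)) = cosh (s - t)"
proof -
  have c: "cosh (s / 2) \<noteq> 0" "cosh (t / 2) \<noteq> 0"
    by simp_all
  have q: "1 - (tanh (x::real))\<^sup>2 = 1 / (cosh x)\<^sup>2" for x
    proof -
    have "(cosh x)\<^sup>2 \<noteq> 0" by simp
    then have "1 - (tanh x)\<^sup>2 = ((cosh x)\<^sup>2 - (sinh x)\<^sup>2) / (cosh x)\<^sup>2"
      unfolding tanh_def power_divide diff_divide_distrib by (subst divide_self) auto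
    also have "(cosh x)\<^sup>2 - (sinh x)\<^sup>2 = 1" by (simp add: cosh_square_eq)
    finally show ?thesis .
  qed
  have "tanh (s / 2) - tanh (t / 2) = sinh (s / 2 - t / 2) / (cosh (s / 2) * cosh (t / 2))"
    unfolding sinh_diff tanh_def using c by (simp add: divide_simps)
  then have "2 * (tanh (s / 2) - tanh (t / 2))\<^sup>2 /
      ((1 - (tanh (s / 2))\<^sup>2) * (1 - (tanh (t / 2))\<^sup>2)) = 2 * (sinh (s / 2 - t / 2))\<^sup>2"
    unfolding q using c by (simp add: power_divide power_mult_distrib)
  also have "\<dots> = cosh (2 * (s / 2 - t / 2)) - 1"
    unfolding cosh_double cosh_square_eq by simp
  finally show ?thesis by (simp add: algebra_simps)
qed

lemma hdist_geodesic:
  assumes "v \<in> T1H"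
  shows "hdist (geodesic v s) (geodesic v t) = \<bar>s - t\<bar>"
proof -
  define \<kappa> where "\<kappa> = snd v / (\<i> * of_real (Im (fst v)))"
  have k: "cmod \<kappa> = 1" and z: "0 < Im (fst v)"
    using T1H_direction[OF assms] by (simp_all add: \<kappa>_def)
  have w: "cmod (of_real (tanh x) * \<kappa>) = \<bar>tanh x\<bar>" for x :: real
    by (simp add: norm_mult k)
  have d: "cmod (of_real (tanh x) * \<kappa> - of_real (tanh y) * \<kappa>) = \<bar>tanh x - tanh y\<bar>" for x y :: real
    using k by (metis left_diff_distrib mult.right_neutral norm_mult norm_of_real of_real_diff)
  have "hdist (geodesic v s) (geodesic v t) = arcosh (cosh (s - t))"
    unfolding geodesic_disc_map \<kappa>_def[symmetric]
    by (subst hdist_disc_map[OF z]) (simp_all add: w d abs_tanh_less_1 tanh_half_sinh)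
  also have "\<dots> = arcosh (cosh \<bar>s - t\<bar>)"
    by simp
  finally show ?thesis
    by (simp only: arcosh_cosh_real abs_ge_zero)
qed

lemma geodesic_has_vector_derivative:
  assumes "v \<in> T1H"
  shows "(geodesic v has_vector_derivative snd (geodesic_flow t v)) (at t)"
proof -
  define \<kappa> where "\<kappa> = snd v / (\<i> * of_real (Im (fst v)))"
  define \<omega> where "\<omega> = of_real (tanh (t / 2)) * \<kappa>"
  have k: "cmod \<kappa> = 1" and z: "0 < Im (fst v)"
    using T1H_direction[OF assms] by (simp_all add: \<kappa>_def)
  have "cmod \<omega> < 1"
    by (simp add: \<omega>_def norm_mult k abs_tanh_less_1)
  then have n: "1 - \<omega> \<noteq> 0" by auto
  have snd_v: "snd v = \<kappa> * (\<i> * of_real (Im (fst v)))"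
    using z by (simp add: \<kappa>_def)
  have "((\<lambda>t. tanh (t / 2)) has_real_derivative (1 - (tanh (t / 2))\<^sup>2) / 2) (at t)"
    by (auto intro!: derivative_eq_intros)
  then have "((\<lambda>t. of_real (tanh (t / 2)) * \<kappa>) has_vector_derivative
      of_real ((1 - (tanh (t / 2))\<^sup>2) / 2) * \<kappa>) (at t)"
    by (intro has_vector_derivative_mult_left has_vector_derivative_of_real)
       (simp add: has_real_derivative_iff_has_vector_derivative)
  moreover have "(disc_map (fst v) has_field_derivative (fst v - cnj (fst v)) / (1 - \<omega>)\<^sup>2) (at \<omega>)"
    unfolding disc_map_def using n
    by (auto intro!: derivative_eq_intros simp: power2_eq_square algebra_simps)
  ultimately have "((disc_map (fst v) \<circ> (\<lambda>t. of_real (tanh (t / 2)) * \<kappa>)) has_vector_derivative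
      of_real ((1 - (tanh (t / 2))\<^sup>2) / 2) * \<kappa> * ((fst v - cnj (fst v)) / (1 - \<omega>)\<^sup>2)) (at t)"
    by (intro field_vector_diff_chain_at) (simp_all add: \<omega>_def)
  moreover have "disc_map (fst v) \<circ> (\<lambda>t. of_real (tanh (t / 2)) * \<kappa>) = geodesic v"
    by (auto simp: geodesic_disc_map \<kappa>_def)
  moreover have "of_real ((1 - (tanh (t / 2))\<^sup>2) / 2) * \<kappa> * ((fst v - cnj (fst v)) / (1 - \<omega>)\<^sup>2) =
      snd (geodesic_flow t v)"
    unfolding geodesic_flow_def Let_def snd_conv \<kappa>_def[symmetric] \<omega>_def[symmetric]
    by (simp add: snd_v complex_diff_cnj)
  ultimately show ?thesis by simp
qed

lemma geodesic_flow_T1H: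
  assumes "v \<in> T1H"
  shows "geodesic_flow t v \<in> T1H"
proof -
  define \<kappa> where "\<kappa> = snd v / (\<i> * of_real (Im (fst v)))"
  define \<omega> where "\<omega> = of_real (tanh (t / 2)) * \<kappa>"
  have k: "cmod \<kappa> = 1" and z: "0 < Im (fst v)" and xi: "cmod (snd v) = Im (fst v)"
    using T1H_direction[OF assms] assms by (auto simp add: \<kappa>_def T1H_def)
  have w: "cmod \<omega> = \<bar>tanh (t / 2)\<bar>"
    by (simp add: \<omega>_def norm_mult k)
  then have w1: "cmod \<omega> < 1"
    by (simp add: abs_tanh_less_1)
  then have n: "cmod (1 - \<omega>) > 0" by auto
  have q: "(tanh (t / 2))\<^sup>2 < 1"
    using abs_tanh_less_1[of "t / 2"] by (simp add: abs_square_less_1)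
  have f: "fst (geodesic_flow t v) = disc_map (fst v) \<omega>"
    by (simp add: geodesic_flow_def Let_def disc_map_def \<kappa>_def \<omega>_def)
  have s: "snd (geodesic_flow t v) = snd v * of_real (1 - (tanh (t / 2))\<^sup>2) / (1 - \<omega>)\<^sup>2"
    by (simp add: geodesic_flow_def Let_def \<kappa>_def \<omega>_def)
  have "Im (fst (geodesic_flow t v)) = Im (fst v) * (1 - (tanh (t / 2))\<^sup>2) / (cmod (1 - \<omega>))\<^sup>2"
    unfolding f Im_disc_map[OF w1] w by simp
  moreover have "cmod (snd (geodesic_flow t v)) = Im (fst v) * (1 - (tanh (t / 2))\<^sup>2) / (cmod (1 - \<omega>))\<^sup>2"
    unfolding s norm_divide norm_mult norm_power norm_of_real xi using q by simp
  moreover have "0 < Im (fst v) * (1 - (tanh (t / 2))\<^sup>2) / (cmod (1 - \<omega>))\<^sup>2"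
    using z q n by simp
  ultimately show ?thesis
    by (auto simp: T1H_def upper_half_plane_def case_prod_beta)
qed

lemma connecting_vector_unique:
  assumes "v \<in> T1H" "w \<in> T1H" "geodesic v 0 \<noteq> geodesic w 0"
  shows "\<exists>!c. c \<in> T1H \<and> geodesic c 0 = geodesic v 0 \<and>
                geodesic c (hdist (geodesic v 0) (geodesic w 0)) = geodesic w 0"
proof -
  define z where "z = fst v"
  define p where "p = fst w"
  define s where "s = hdist z p"
  define \<tau> where "\<tau> = tanh (s / 2)"
  define \<omega> where "\<omega> = (p - z) / (p - cnj z)"
  have z: "0 < Im z" and p: "0 < Im p" and zp: "z \<noteq> p"
    using assms by (auto simp: T1H_def upper_half_plane_def z_def p_def geodesic_0)
  have pz: "p - cnj z \<noteq> 0"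
    using z p by (auto simp: complex_eq_iff)
  have zz: "z - cnj z \<noteq> 0"
    using z by (auto simp: complex_eq_iff)
  have om1: "1 - \<omega> = (z - cnj z) / (p - cnj z)"
    using pz by (simp add: \<omega>_def divide_simps)
  have solve: "disc_map z x = p \<longleftrightarrow> x = \<omega>" if "cmod x < 1" for x
  proof -
    have "1 - x \<noteq> 0" using that by auto
    then have "disc_map z x = p \<longleftrightarrow> z - cnj z * x = p * (1 - x)"
      unfolding disc_map_def by (simp add: divide_simps)
    also have "\<dots> \<longleftrightarrow> x * (p - cnj z) = p - z"
      by (auto simp: algebra_simps)
    also have "\<dots> \<longleftrightarrow> x = \<omega>"
      using pz by (auto simp: \<omega>_def divide_simps)
    finally show ?thesis .
  qed
  have "(cmod (p - z))\<^sup>2 < (cmod (p - cnj z))\<^sup>2"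
    using z p unfolding cmod_power2 by (simp add: power2_eq_square algebra_simps)
  then have "cmod (p - z) < cmod (p - cnj z)"
    by (simp add: power_less_imp_less_base)
  then have om: "cmod \<omega> < 1"
    using pz by (simp add: \<omega>_def norm_divide divide_simps)
  have om0: "\<omega> \<noteq> 0"
    using zp pz by (simp add: \<omega>_def)
  define r where "r = 2 * artanh (cmod \<omega>)"
  have r: "tanh (r / 2) = cmod \<omega>"
    proof -
    have a: "0 < (1 + cmod \<omega>) / (1 - cmod \<omega>)"
      using om by (intro divide_pos_pos) (simp_all add: add_pos_nonneg)
    have "exp (- r) = (1 - cmod \<omega>) / (1 + cmod \<omega>)"
      unfolding r_def artanh_def using a by (simp add: exp_minus)
    then have "tanh (r / 2) = (1 - (1 - cmod \<omega>) / (1 + cmod \<omega>)) / (1 + (1 - cmod \<omega>) / (1 + cmod \<omega>))"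
      by (simp add: tanh_real_altdef)
    then show ?thesis
      using norm_ge_zero[of \<omega>] by (auto simp: divide_simps split: if_splits)
  qed
  have r0: "0 \<le> r"
  proof (rule ccontr)
    assume "\<not> 0 \<le> r"
    then have "tanh (r / 2) < 0" by simp
    then show False using r by simp
  qed
  have k: "cmod (\<omega> / of_real (cmod \<omega>)) = 1" using om0 by (simp add: norm_divide)
  define c0 where "c0 = (z, \<omega> / of_real (cmod \<omega>) * (\<i> * of_real (Im z)))"
  have c0: "c0 \<in> T1H" "fst c0 = z"
    using z om0 by (simp_all add: T1H_def upper_half_plane_def c0_def norm_mult norm_divide)
  have "geodesic c0 r = disc_map z (of_real (cmod \<omega>) * (\<omega> / of_real (cmod \<omega>)))"
    using z by (simp add: geodesic_disc_map c0_def r)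
  also have "\<dots> = p"
    using solve[OF om] om0 by simp
  finally have g: "geodesic c0 r = p" .
  have "s = r"
    using hdist_geodesic[OF c0(1), of 0 r] r0 by (simp add: g geodesic_0 c0 s_def)
  then have g: "geodesic c0 s = p" and tau: "\<tau> = cmod \<omega>"
    using g r by (simp_all add: \<tau>_def)
  have "c = c0" if c: "c \<in> T1H" "fst c = z" "geodesic c s = p" for c
  proof -
    have "cmod (snd c / (\<i> * of_real (Im z))) = 1"
      using T1H_direction(2)[OF c(1)] c(2) by simp
    then have "cmod (of_real \<tau> * (snd c / (\<i> * of_real (Im z)))) = \<tau>"
      by (simp only: norm_mult) (simp add: tau)
    then have lt: "cmod (of_real \<tau> * (snd c / (\<i> * of_real (Im z)))) < 1"
      using om tau by simp
    have "disc_map z (of_real \<tau> * (snd c / (\<i> * of_real (Im z)))) = p"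
      using c(3) by (simp add: geodesic_disc_map c(2) \<tau>_def)
    then have "of_real \<tau> * (snd c / (\<i> * of_real (Im z))) = \<omega>"
      using solve[OF lt] by simp
    then have "snd c = \<omega> / of_real (cmod \<omega>) * (\<i> * of_real (Im z))"
      using z om0 by (auto simp: tau divide_simps mult_ac)
    then show ?thesis using c(2) by (simp add: c0_def prod_eq_iff)
  qed
  then show ?thesis
    using c0 g unfolding geodesic_0 s_def z_def p_def by blast
qed

lemma group_SL2R: "group SL2R"
proof (rule groupI)
  fix A assume "A \<in> carrier SL2R"
  then have d: "det A = 1" by (simp add: SL2R_def)
  then have "invertible A" by (simp add: invertible_det_nz)
  then obtain B where B: "B ** A = mat 1" unfolding invertible_def by blast
  have "det (B ** A) = 1" unfolding B by (simp add: det_I)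
  then have "det B = 1" by (simp add: det_mul d)
  then show "\<exists>B\<in>carrier SL2R. B \<otimes>\<^bsub>SL2R\<^esub> A = \<one>\<^bsub>SL2R\<^esub>" using B by (auto simp: SL2R_def)
qed (simp_all add: SL2R_def det_mul det_I matrix_mul_assoc)

lemma carrier_PSL2R: "carrier PSL2R = {{A, - A} | A. det A = 1}"
proof -
  have m: "(- mat 1) ** A = - A" for A :: "real ^ 2 ^ 2"
    by (simp add: vec_eq_iff matrix_matrix_mult_def mat_def sum_2 forall_2)
  show ?thesis
    unfolding PSL2R_def carrier_FactGroup by (auto simp: SL2R_def r_coset_def m)
qed

lemma normal_PSL2R: "{mat 1, - mat 1} \<lhd> SL2R"
proof -
  interpret group SL2R by (rule group_SL2R)
  have m: "(- mat 1) ** A = - A" "A ** (- mat 1) = - A" for A :: "real ^ 2 ^ 2"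
    by (simp_all add: vec_eq_iff matrix_matrix_mult_def mat_def sum_2 forall_2)
  have d: "det (- mat 1 :: real ^ 2 ^ 2) = 1"
    by (simp add: det_2 mat_def)
  have "inv\<^bsub>SL2R\<^esub> (- mat 1) = - mat 1"
    by (rule inv_equality) (simp_all add: SL2R_def m d)
  moreover have "inv\<^bsub>SL2R\<^esub> (mat 1) = mat 1"
    by (rule inv_equality) (simp_all add: SL2R_def)
  ultimately have "subgroup {mat 1, - mat 1} SL2R"
    by unfold_locales (auto simp: d m SL2R_def)
  then show ?thesis
    by (rule normalI) (auto simp: r_coset_def l_coset_def SL2R_def m)
qed

lemma group_PSL2R: "group PSL2R"
  unfolding PSL2R_def by (rule normal.factorgroup_is_group[OF normal_PSL2R])

lemma SL2R_act_uminus: "SL2R_act (- A) v = SL2R_act A v"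
proof -
  have "of_real ((- A) $ 2 $ 1) * fst v + of_real ((- A) $ 2 $ 2) =
      - (of_real (A $ 2 $ 1) * fst v + of_real (A $ 2 $ 2))"
    "of_real ((- A) $ 1 $ 1) * fst v + of_real ((- A) $ 1 $ 2) =
      - (of_real (A $ 1 $ 1) * fst v + of_real (A $ 1 $ 2))"
    by simp_all
  then show ?thesis
    unfolding SL2R_act_def Let_def by (simp only: minus_divide_divide power2_minus)
qed

lemma PSL2R_act_rep:
  assumes "\<gamma> \<in> carrier PSL2R" "A \<in> \<gamma>"
  shows "PSL2R_act \<gamma> v = SL2R_act A v"
proof -
  have "(SOME B. B \<in> \<gamma>) \<in> \<gamma>" using assms(2) by (rule someI)
  then have "(SOME B. B \<in> \<gamma>) = A \<or> (SOME B. B \<in> \<gamma>) = - A"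
    using assms by (auto simp: carrier_PSL2R)
  then show ?thesis unfolding PSL2R_act_def by (metis SL2R_act_uminus)
qed

end

theory Submission
  imports Defs
begin

text \<open>Why the two strong stable sets agree: \<open>d1\<close> and \<open>d2\<close> are uniformly equivalent on \<open>T1H\<close>, and
  this survives the passage to the infimum over \<open>\<Gamma>\<close>.

  Both distances contain the distance \<open>s\<close> of the base points. Beyond it, \<open>d2\<close> contains the angle
  \<open>\<theta>\<close> between the two vectors, compared along the geodesic that joins their base points, while \<open>d1\<close>
  contains the distance \<open>D\<close> after unit time. In the Poincare disc centred at the first base point,
  with the joining geodesic on the real axis, the two points at time \<open>t\<close> are \<open>\<tau> * a\<close> and
  \<open>(\<sigma> + \<tau> * b) / (1 + \<sigma> * \<tau> * b)\<close>, where \<open>\<sigma> = tanh (s / 2)\<close>, \<open>\<tau> = tanh (t / 2)\<close> and the unit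
  complex numbers \<open>a\<close> and \<open>b\<close> give the directions of the vectors. Their hyperbolic distance is
  explicit (\<open>cosh_hdist_rotated\<close>). As \<open>\<bar>a - b\<bar> = 2 * sin (\<theta> / 2)\<close>, it yields the estimate
  \<open>\<bar>sinh (D / 2) - sinh t * cosh (s / 2) * sin (\<theta> / 2)\<bar> \<le> cosh t * sinh (s / 2)\<close>
  of \<open>d2_angle_estimate\<close>. For \<open>t = 1\<close> it shows that, as soon as \<open>s\<close> tends to \<open>0\<close>, \<open>D\<close> tends to \<open>0\<close>
  exactly when \<open>\<theta>\<close> does (\<open>tendsto_0_d1_iff_d2\<close>). Nothing in this depends on where in \<open>T1H\<close>
  the vectors are, so it may be used along curves whose lifts to \<open>T1H\<close> run off to infinity.

  On the quotient, choose for each time an element of \<open>\<Gamma>\<close> that realises the infimum defining one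
  distance up to an error tending to \<open>0\<close>. For these choices that distance of the lifts tends to
  \<open>0\<close>, hence so does the other one, and it bounds the other infimum from above
  (\<open>tendsto_0_Inf_transfer\<close>).\<close>


section \<open>Geodesics in disc coordinates\<close>

lemma tanh_square_cosh: "1 - (tanh (x::real))\<^sup>2 = 1 / (cosh x)\<^sup>2"
proof -
  have "(cosh x)\<^sup>2 \<noteq> 0" by simp
  then have "1 - (tanh x)\<^sup>2 = ((cosh x)\<^sup>2 - (sinh x)\<^sup>2) / (cosh x)\<^sup>2"
    unfolding tanh_def power_divide diff_divide_distrib by (subst divide_self) auto
  then show ?thesis by (simp add: cosh_square_eq)
qed

lemma hdist_nonneg:
  assumes "0 < Im z" "0 < Im w"
  shows "0 \<le> hdist z w"
  using assms by (simp add: hdist_def arcosh_nonneg_real)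

lemma geodesic_Im_pos:
  assumes "v \<in> T1H"
  shows "0 < Im (geodesic v t)"
  using geodesic_flow_T1H[OF assms, of t]
  by (auto simp: geodesic_def T1H_def upper_half_plane_def case_prod_beta)

lemma hdist_geodesic_nonneg:
  assumes "v \<in> T1H" "w \<in> T1H"
  shows "0 \<le> hdist (geodesic v t) (geodesic w t)"
  using assms by (intro hdist_nonneg geodesic_Im_pos)

text \<open>Recentring the disc: the isometry based at \<open>disc_map z \<omega>\<close> differs from the one based at \<open>z\<close> by
  the disc translation taking \<open>0\<close> to \<open>\<omega>\<close>. The unimodular factor \<open>cnj (1 - \<omega>) / (1 - \<omega>)\<close>
  appears because both isometries send the direction \<open>1\<close> at \<open>0\<close> to the vertical, a normalisation
  that the translation alone does not respect.\<close>

lemma disc_map_disc_map: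
  assumes "cmod \<omega> < 1" "cmod \<eta> < 1"
  shows "disc_map (disc_map z \<omega>) (\<eta> * (cnj (1 - \<omega>) / (1 - \<omega>))) =
    disc_map z ((\<omega> + \<eta>) / (1 + cnj \<omega> * \<eta>))"
proof -
  have n: "1 - \<omega> \<noteq> 0" "1 - cnj \<omega> \<noteq> 0"
  proof -
    show "1 - \<omega> \<noteq> 0" using assms(1) by auto
    then show "1 - cnj \<omega> \<noteq> 0"
      by (metis complex_cnj_cancel_iff complex_cnj_diff complex_cnj_one eq_iff_diff_eq_0)
  qed
  have "cmod (cnj \<omega> * \<eta>) < 1"
    using assms mult_strict_mono[of "cmod \<omega>" 1 "cmod \<eta>" 1] by (simp add: norm_mult)
  then have m: "1 + cnj \<omega> * \<eta> \<noteq> 0"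
    by (metis add.commute add_eq_0_iff norm_minus_cancel norm_one less_irrefl)
  have "disc_map (disc_map z \<omega>) (\<eta> * (cnj (1 - \<omega>) / (1 - \<omega>))) =
      ((z - cnj z * \<omega>) - (cnj z - z * cnj \<omega>) * \<eta>) / ((1 - \<omega>) - \<eta> * (1 - cnj \<omega>))"
    (is "_ = ?q")
  proof -
    have "disc_map z \<omega> - cnj (disc_map z \<omega>) * (\<eta> * (cnj (1 - \<omega>) / (1 - \<omega>))) =
        ((z - cnj z * \<omega>) - (cnj z - z * cnj \<omega>) * \<eta>) / (1 - \<omega>)"
      using n by (simp add: disc_map_def divide_simps)
    moreover have "1 - \<eta> * (cnj (1 - \<omega>) / (1 - \<omega>)) = ((1 - \<omega>) - \<eta> * (1 - cnj \<omega>)) / (1 - \<omega>)"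
      using n by (simp add: divide_simps)
    ultimately show ?thesis
      using n by (simp add: disc_map_def[of "disc_map z \<omega>"])
  qed
  also have "?q = (z * (1 + cnj \<omega> * \<eta>) - cnj z * (\<omega> + \<eta>)) / ((1 + cnj \<omega> * \<eta>) - (\<omega> + \<eta>))"
    by (simp add: algebra_simps)
  also have "\<dots> = disc_map z ((\<omega> + \<eta>) / (1 + cnj \<omega> * \<eta>))"
  proof -
    have "z - cnj z * ((\<omega> + \<eta>) / (1 + cnj \<omega> * \<eta>)) =
        (z * (1 + cnj \<omega> * \<eta>) - cnj z * (\<omega> + \<eta>)) / (1 + cnj \<omega> * \<eta>)"
      using m by (simp add: divide_simps)
    moreover have "1 - (\<omega> + \<eta>) / (1 + cnj \<omega> * \<eta>) =
        ((1 + cnj \<omega> * \<eta>) - (\<omega> + \<eta>)) / (1 + cnj \<omega> * \<eta>)"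
      using m by (simp add: divide_simps)
    ultimately show ?thesis using m by (simp add: disc_map_def[of z])
  qed
  finally show ?thesis .
qed

text \<open>Along a geodesic the disc direction turns by exactly the unimodular factor of
  \<open>disc_map_disc_map\<close>: the two cancel when the disc is recentred at a point of the geodesic.\<close>

lemma flow_direction:
  fixes s :: real
  assumes "c \<in> T1H"
  defines "\<kappa> \<equiv> snd c / (\<i> * of_real (Im (fst c)))"
  defines "\<omega> \<equiv> of_real (tanh (s / 2)) * \<kappa>"
  shows "snd (geodesic_flow s c) / (\<i> * of_real (Im (geodesic c s))) =
    \<kappa> * (cnj (1 - \<omega>) / (1 - \<omega>))"
proof -
  have k: "cmod \<kappa> = 1" and z: "0 < Im (fst c)"
    using T1H_direction[OF assms(1)] by (simp_all add: \<kappa>_def)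
  have w: "cmod \<omega> = \<bar>tanh (s / 2)\<bar>"
    by (simp add: \<omega>_def norm_mult k)
  then have w1: "cmod \<omega> < 1"
    by (simp add: abs_tanh_less_1)
  then have n: "1 - \<omega> \<noteq> 0" by auto
  have q: "1 - (tanh (s / 2))\<^sup>2 \<noteq> 0"
    by (simp add: tanh_square_cosh)
  have "snd c = \<kappa> * (\<i> * of_real (Im (fst c)))"
    using z by (simp add: \<kappa>_def)
  then have "snd (geodesic_flow s c) =
      \<kappa> * (\<i> * of_real (Im (fst c))) * of_real (1 - (tanh (s / 2))\<^sup>2) / (1 - \<omega>)\<^sup>2"
    by (simp add: geodesic_flow_def Let_def \<kappa>_def \<omega>_def)
  moreover have "of_real (Im (geodesic c s)) =
      of_real (Im (fst c)) * of_real (1 - (tanh (s / 2))\<^sup>2) / ((1 - \<omega>) * cnj (1 - \<omega>))"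
  proof -
    have "Im (geodesic c s) = Im (fst c) * (1 - (tanh (s / 2))\<^sup>2) / (cmod (1 - \<omega>))\<^sup>2"
      unfolding geodesic_disc_map \<kappa>_def[symmetric] \<omega>_def[symmetric] Im_disc_map[OF w1] w by simp
    then show ?thesis
      by (simp only: complex_norm_square[symmetric] of_real_mult of_real_divide of_real_power)
  qed
  ultimately have "snd (geodesic_flow s c) / (\<i> * of_real (Im (geodesic c s))) =
      \<kappa> * (\<i> * of_real (Im (fst c))) * of_real (1 - (tanh (s / 2))\<^sup>2) / (1 - \<omega>)\<^sup>2 /
      (\<i> * (of_real (Im (fst c)) * of_real (1 - (tanh (s / 2))\<^sup>2) / ((1 - \<omega>) * cnj (1 - \<omega>))))"
    by simp
  also have "\<dots> = \<kappa> * (cnj (1 - \<omega>) / (1 - \<omega>))"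
  proof -
    have "of_real (1 - (tanh (s / 2))\<^sup>2) \<noteq> (0::complex)" "of_real (Im (fst c)) \<noteq> (0::complex)"
      using q z by (simp_all only: of_real_eq_0_iff) simp_all
    moreover have "\<kappa> * (\<i> * I) * r / e\<^sup>2 / (\<i> * (I * r / (e * e'))) = \<kappa> * (e' / e)"
      if "r \<noteq> 0" "I \<noteq> 0" "e \<noteq> 0" for I r e e' :: complex
      using that by (simp add: field_simps power2_eq_square)
    ultimately show ?thesis using n by blast
  qed
  finally show ?thesis .
qed


section \<open>Two vectors on a common geodesic turned by given angles\<close>

text \<open>A law of cosines for the broken line of lengths \<open>t\<close>, \<open>s\<close>, \<open>t\<close>: two vectors lie a
  distance \<open>s\<close> apart on the geodesic of \<open>c\<close> and are rotated by the unit complex numbers \<open>a\<close> and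
  \<open>b\<close>; both are then followed for time \<open>t\<close>. In disc coordinates at the base point of \<open>c\<close> the first
  endpoint is \<open>\<tau> * a\<close> and the second is the image of \<open>\<tau> * b\<close> under the translation by \<open>\<sigma>\<close>, both
  turned by the direction \<open>\<kappa>\<close> of \<open>c\<close>.\<close>

lemma cosh_hdist_rotated:
  fixes s t :: real
  assumes c: "c \<in> T1H" and a: "cmod a = 1" and b: "cmod b = 1"
  defines "\<sigma> \<equiv> tanh (s / 2)" and "\<tau> \<equiv> tanh (t / 2)"
  shows "cosh (hdist (geodesic (fst c, a * snd c) t)
               (geodesic (geodesic c s, b * snd (geodesic_flow s c)) t)) =
    1 + 2 * (cmod (of_real \<tau> * (a - b) - of_real \<sigma> * (1 - of_real (\<tau>\<^sup>2) * a * b)))\<^sup>2 /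
      ((1 - \<tau>\<^sup>2)\<^sup>2 * (1 - \<sigma>\<^sup>2))"
proof -
  define z where "z = fst c"
  define \<kappa> where "\<kappa> = snd c / (\<i> * of_real (Im z))"
  define \<omega> where "\<omega> = of_real \<sigma> * \<kappa>"
  define x where "x = of_real \<tau> * a * \<kappa>"
  define y where "y = of_real \<tau> * b * \<kappa>"
  have k: "cmod \<kappa> = 1" and z: "0 < Im z"
    using T1H_direction[OF c] by (simp_all add: \<kappa>_def z_def)
  have kk: "\<kappa> * cnj \<kappa> = 1"
    using k by (simp add: complex_norm_square[symmetric])
  have \<sigma>: "\<bar>\<sigma>\<bar> < 1" and \<tau>: "\<bar>\<tau>\<bar> < 1"
    by (simp_all add: \<sigma>_def \<tau>_def abs_tanh_less_1)
  have \<sigma>2: "1 - \<sigma>\<^sup>2 > 0" and \<tau>2: "1 - \<tau>\<^sup>2 > 0"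
    using \<sigma> \<tau> by (simp_all add: abs_square_less_1)
  have n: "cmod \<omega> = \<bar>\<sigma>\<bar>" "cmod x = \<bar>\<tau>\<bar>" "cmod y = \<bar>\<tau>\<bar>"
    using k a b by (simp_all add: \<omega>_def x_def y_def norm_mult)
  have wy: "cnj \<omega> * y = of_real (\<sigma> * \<tau>) * b"
    using kk by (simp add: \<omega>_def y_def mult_ac)
  define e where "e = 1 + of_real (\<sigma> * \<tau>) * b"
  have "cmod (of_real (\<sigma> * \<tau>) * b) < 1"
    using \<sigma> \<tau> b mult_strict_mono[of "\<bar>\<sigma>\<bar>" 1 "\<bar>\<tau>\<bar>" 1] by (simp add: norm_mult)
  then have e: "e \<noteq> 0"
    unfolding e_def by (metis add.commute add_eq_0_iff norm_minus_cancel norm_one less_irrefl)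
  define y' where "y' = (\<omega> + y) / e"
  have g1: "geodesic (fst c, a * snd c) t = disc_map z x"
    by (simp add: geodesic_disc_map x_def \<kappa>_def z_def \<tau>_def mult_ac)
  have g2: "geodesic (geodesic c s, b * snd (geodesic_flow s c)) t = disc_map z y'"
  proof -
    have "geodesic (geodesic c s, b * snd (geodesic_flow s c)) t =
        disc_map (geodesic c s)
          (of_real \<tau> * b * (snd (geodesic_flow s c) / (\<i> * of_real (Im (geodesic c s)))))"
      by (simp add: geodesic_disc_map[of "(_, _)"] \<tau>_def mult_ac)
    also have "\<dots> = disc_map (disc_map z \<omega>) (y * (cnj (1 - \<omega>) / (1 - \<omega>)))"
      unfolding flow_direction[OF c]
      by (simp add: geodesic_disc_map \<omega>_def \<sigma>_def \<kappa>_def z_def y_def mult_ac)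
    also have "\<dots> = disc_map z y'"
      by (subst disc_map_disc_map) (use n \<sigma> \<tau> in \<open>simp_all add: y'_def e_def wy\<close>)
    finally show ?thesis .
  qed
  \<comment> \<open>\<open>y'\<close> is the image of \<open>y\<close> under the disc translation by \<open>\<omega>\<close>, for which the defect
     \<open>1 - \<bar>y\<bar>\<^sup>2\<close> transforms by the factor \<open>(1 - \<bar>\<omega>\<bar>\<^sup>2) / \<bar>e\<bar>\<^sup>2\<close>.\<close>
  have ny: "1 - (cmod y')\<^sup>2 = (1 - \<sigma>\<^sup>2) * (1 - \<tau>\<^sup>2) / (cmod e)\<^sup>2"
  proof -
    have bb: "(Re b)\<^sup>2 + (Im b)\<^sup>2 = 1"
      using b by (metis cmod_power2 one_power2)
    have "\<omega> + y = \<kappa> * (of_real \<sigma> + of_real \<tau> * b)"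
      by (simp add: \<omega>_def y_def algebra_simps)
    then have "(cmod (\<omega> + y))\<^sup>2 = \<sigma>\<^sup>2 + 2 * \<sigma> * \<tau> * Re b + \<tau>\<^sup>2 * ((Re b)\<^sup>2 + (Im b)\<^sup>2)"
      by (simp add: norm_mult k cmod_power2) (simp add: power2_eq_square algebra_simps)
    moreover have "(cmod e)\<^sup>2 = 1 + 2 * \<sigma> * \<tau> * Re b + \<sigma>\<^sup>2 * \<tau>\<^sup>2 * ((Re b)\<^sup>2 + (Im b)\<^sup>2)"
      by (simp add: e_def cmod_power2) (simp add: power2_eq_square algebra_simps)
    ultimately have "(cmod e)\<^sup>2 - (cmod (\<omega> + y))\<^sup>2 = (1 - \<sigma>\<^sup>2) * (1 - \<tau>\<^sup>2)"
      unfolding bb by (simp add: algebra_simps)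
    then show ?thesis
      using e by (simp add: y'_def norm_divide power_divide field_simps)
  qed
  then have "1 - (cmod y')\<^sup>2 > 0"
    using \<sigma>2 \<tau>2 e by simp
  then have y'1: "cmod y' < 1"
    by (simp add: abs_square_less_1)
  have "x - y' = \<kappa> * (of_real \<tau> * (a - b) - of_real \<sigma> * (1 - of_real (\<tau>\<^sup>2) * a * b)) / e"
    using e by (simp add: x_def y'_def \<omega>_def y_def divide_simps)
      (simp add: e_def algebra_simps power2_eq_square)
  then have d: "cmod (x - y') =
      cmod (of_real \<tau> * (a - b) - of_real \<sigma> * (1 - of_real (\<tau>\<^sup>2) * a * b)) / cmod e"
    by (simp add: norm_divide norm_mult k)
  have "cosh (hdist (disc_map z x) (disc_map z y')) =
      1 + 2 * (cmod (x - y'))\<^sup>2 / ((1 - (cmod x)\<^sup>2) * (1 - (cmod y')\<^sup>2))"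
  proof -
    have "0 \<le> 2 * (cmod (x - y'))\<^sup>2 / ((1 - (cmod x)\<^sup>2) * (1 - (cmod y')\<^sup>2))"
      using n \<tau>2 \<open>1 - (cmod y')\<^sup>2 > 0\<close> by simp
    then show ?thesis
      using n \<tau> by (simp add: hdist_disc_map[OF z _ y'1] cosh_arcosh_real)
  qed
  also have "\<dots> = 1 + 2 * (cmod (of_real \<tau> * (a - b) - of_real \<sigma> * (1 - of_real (\<tau>\<^sup>2) * a * b)))\<^sup>2 /
      ((1 - \<tau>\<^sup>2)\<^sup>2 * (1 - \<sigma>\<^sup>2))"
    unfolding d ny n(2) using e \<sigma>2 \<tau>2 by (simp add: power_divide) (simp add: divide_simps power2_eq_square)
  finally show ?thesis unfolding g1 g2 .
qed

text \<open>The numerator in \<open>cosh_hdist_rotated\<close> is \<open>\<tau> * (a - b)\<close> up to a term of size at most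
  \<open>\<sigma> * (1 + \<tau>\<^sup>2)\<close>. Passing to half the distance removes the square, and the double-angle formulas
  turn the remaining factors into functions of \<open>t\<close> and \<open>s / 2\<close>.\<close>

lemma sinh_half_hdist_rotated:
  assumes c: "c \<in> T1H" and a: "cmod a = 1" and b: "cmod b = 1" and "0 \<le> s" "0 \<le> t"
  defines "D \<equiv> hdist (geodesic (fst c, a * snd c) t)
      (geodesic (geodesic c s, b * snd (geodesic_flow s c)) t)"
  shows "\<bar>sinh (D / 2) - sinh t * cosh (s / 2) * (cmod (a - b) / 2)\<bar> \<le> cosh t * sinh (s / 2)"
proof -
  define \<sigma> where "\<sigma> = tanh (s / 2)"
  define \<tau> where "\<tau> = tanh (t / 2)"
  define N where "N = cmod (of_real \<tau> * (a - b) - of_real \<sigma> * (1 - of_real (\<tau>\<^sup>2) * a * b))"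
  define K where "K = (cosh (t / 2))\<^sup>2 * cosh (s / 2)"
  have "(fst c, a * snd c) \<in> T1H" "(geodesic c s, b * snd (geodesic_flow s c)) \<in> T1H"
    using c geodesic_flow_T1H[OF c, of s] a b
    by (auto simp: T1H_def geodesic_def norm_mult case_prod_beta)
  then have D: "0 \<le> D"
    unfolding D_def by (rule hdist_geodesic_nonneg)
  have \<sigma>0: "0 \<le> \<sigma>" and \<tau>0: "0 \<le> \<tau>"
    using assms by (simp_all add: \<sigma>_def \<tau>_def)
  have K0: "0 < K" by (simp add: K_def)
  have "2 * (sinh (D / 2))\<^sup>2 = cosh D - 1"
    using cosh_double[of "D / 2"] by (simp add: cosh_square_eq)
  also have "\<dots> = 2 * (K * N)\<^sup>2"
    unfolding D_def cosh_hdist_rotated[OF c a b] N_def K_def \<sigma>_def \<tau>_def tanh_square_cosh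
    by (simp add: power_divide power_mult_distrib)
  finally have "sinh (D / 2) = K * N"
    using D K0 by (simp add: N_def power2_eq_iff_nonneg)
  moreover have "\<bar>N - \<tau> * cmod (a - b)\<bar> \<le> \<sigma> * (1 + \<tau>\<^sup>2)"
  proof -
    have "cmod (1 - of_real (\<tau>\<^sup>2) * a * b) \<le> 1 + \<tau>\<^sup>2"
      using norm_triangle_ineq4[of 1 "of_real (\<tau>\<^sup>2) * a * b"] a b by (simp add: norm_mult norm_power)
    then have "cmod (of_real \<sigma> * (1 - of_real (\<tau>\<^sup>2) * a * b)) \<le> \<sigma> * (1 + \<tau>\<^sup>2)"
      using \<sigma>0 by (simp add: norm_mult mult_left_mono)
    moreover have "\<bar>N - cmod (of_real \<tau> * (a - b))\<bar> \<le>
        cmod (of_real \<sigma> * (1 - of_real (\<tau>\<^sup>2) * a * b))"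
      unfolding N_def by (metis norm_triangle_ineq3 norm_minus_commute diff_diff_eq2 add_diff_cancel_left' minus_diff_eq)
    ultimately show ?thesis
      using \<tau>0 by (simp add: norm_mult)
  qed
  then have "\<bar>K * N - K * (\<tau> * cmod (a - b))\<bar> \<le> K * (\<sigma> * (1 + \<tau>\<^sup>2))"
    using K0 by (simp add: abs_mult flip: right_diff_distrib)
  moreover have "K * (\<tau> * cmod (a - b)) = sinh t * cosh (s / 2) * (cmod (a - b) / 2)"
    using sinh_double[of "t / 2"] by (simp add: K_def \<tau>_def tanh_def power2_eq_square)
  moreover have "K * (\<sigma> * (1 + \<tau>\<^sup>2)) = cosh t * sinh (s / 2)"
    using cosh_double[of "t / 2"]
    by (simp add: K_def \<sigma>_def \<tau>_def tanh_def power_divide algebra_simps)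
  ultimately show ?thesis by simp
qed


section \<open>Uniform equivalence of the two distances\<close>

text \<open>Chord length in terms of arc length. The distance on the circle is used here: replacing
  \<open>\<bar>\<alpha> - \<beta>\<bar>\<close> by \<open>2 * pi - \<bar>\<alpha> - \<beta>\<bar>\<close> leaves the sine of the half-angle unchanged.\<close>

lemma cmod_diff_eq_sin_angle_diff:
  assumes "cmod a = 1" "cmod b = 1"
  shows "cmod (a - b) = 2 * sin (angle_diff (Arg2pi a) (Arg2pi b) / 2)"
proof -
  define \<alpha> where "\<alpha> = Arg2pi a"
  define \<beta> where "\<beta> = Arg2pi b"
  have ab: "a = cis \<alpha>" "b = cis \<beta>"
    using assms Arg2pi_eq[of a] Arg2pi_eq[of b] by (simp_all add: \<alpha>_def \<beta>_def cis_conv_exp)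
  have r: "0 \<le> \<alpha>" "\<alpha> < 2 * pi" "0 \<le> \<beta>" "\<beta> < 2 * pi"
    by (simp_all add: \<alpha>_def \<beta>_def Arg2pi_ge_0 Arg2pi_lt_2pi)
  have "sin ((2 * pi - \<bar>\<alpha> - \<beta>\<bar>) / 2) = sin (\<bar>\<alpha> - \<beta>\<bar> / 2)"
    by (simp add: diff_divide_distrib sin_diff)
  then have "sin (angle_diff \<alpha> \<beta> / 2) = sin (\<bar>\<alpha> - \<beta>\<bar> / 2)"
    by (simp add: angle_diff_def min_def)
  also have "\<dots> = \<bar>sin ((\<alpha> - \<beta>) / 2)\<bar>"
  proof -
    have "0 \<le> sin (\<bar>\<alpha> - \<beta>\<bar> / 2)"
      using r by (intro sin_ge_zero) auto
    moreover have "sin (\<bar>\<alpha> - \<beta>\<bar> / 2) = sin ((\<alpha> - \<beta>) / 2) \<or>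
        sin (\<bar>\<alpha> - \<beta>\<bar> / 2) = - sin ((\<alpha> - \<beta>) / 2)"
      unfolding sin_minus[symmetric] minus_divide_left by (auto simp: abs_if)
    ultimately show ?thesis by linarith
  qed
  finally have "sin (angle_diff \<alpha> \<beta> / 2) = \<bar>sin ((\<alpha> - \<beta>) / 2)\<bar>" .
  moreover have "cmod (cis \<alpha> - cis \<beta>) = 2 * \<bar>sin ((\<alpha> - \<beta>) / 2)\<bar>"
  proof -
    have "(cmod (cis \<alpha> - cis \<beta>))\<^sup>2 = 2 - 2 * cos (\<alpha> - \<beta>)"
      using sin_cos_squared_add[of \<alpha>] sin_cos_squared_add[of \<beta>]
      unfolding cmod_power2 by (simp add: cos_diff power2_eq_square algebra_simps)
    also have "\<dots> = (2 * \<bar>sin ((\<alpha> - \<beta>) / 2)\<bar>)\<^sup>2"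
      using cos_double_sin[of "(\<alpha> - \<beta>) / 2"]
      by (simp only: power_mult_distrib power2_abs nonzero_mult_div_cancel_left times_divide_eq_right) simp
    finally show ?thesis
      by (rule power2_eq_imp_eq) simp_all
  qed
  ultimately have "cmod (a - b) = 2 * sin (angle_diff \<alpha> \<beta> / 2)"
    by (simp add: ab)
  then show ?thesis by (simp only: \<alpha>_def \<beta>_def)
qed

text \<open>Any two vectors are obtained by rotation from two vectors on a common geodesic, namely
  the one of the connecting vector, so \<open>sinh_half_hdist_rotated\<close> applies. Letting \<open>\<theta>\<close> be given by
  \<open>d2 v w = s + \<theta>\<close> hides the connecting vector from everything that follows.\<close>

lemma d2_angle_estimate:
  assumes v: "v \<in> T1H" and w: "w \<in> T1H"
  defines "s \<equiv> hdist (fst v) (fst w)"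
  obtains \<theta> where "d2 v w = s + \<theta>" "0 \<le> \<theta>" "\<theta> \<le> pi"
    "\<And>t. 0 \<le> t \<Longrightarrow> \<bar>sinh (hdist (geodesic v t) (geodesic w t) / 2) -
       sinh t * cosh (s / 2) * sin (\<theta> / 2)\<bar> \<le> cosh t * sinh (s / 2)"
proof -
  define c where "c = connecting_vector v w"
  have c: "c \<in> T1H" "fst c = fst v" "geodesic c s = fst w"
  proof -
    have "c \<in> T1H \<and> geodesic c 0 = geodesic v 0 \<and> geodesic c s = geodesic w 0"
      \<comment> \<open>If the base points agree, the connecting vector is \<open>v\<close> by convention, and \<open>s = 0\<close>.\<close>
    proof (cases "geodesic v 0 = geodesic w 0")
      case True
      moreover have "s = 0"
        using True by (simp add: s_def geodesic_0 hdist_def)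
      ultimately show ?thesis
        using v by (simp add: c_def connecting_vector_def)
    next
      case False
      then show ?thesis
        using theI'[OF connecting_vector_unique[OF v w False]]
        by (simp add: c_def connecting_vector_def s_def geodesic_0)
    qed
    then show "c \<in> T1H" "fst c = fst v" "geodesic c s = fst w"
      by (simp_all add: geodesic_0)
  qed
  have "0 \<le> s"
    using hdist_geodesic_nonneg[OF v w, of 0] by (simp add: s_def geodesic_0)
  define c' where "c' = geodesic_flow s c"
  have c': "c' \<in> T1H" "fst c' = fst w"
    using geodesic_flow_T1H[OF c(1)] c(3) by (auto simp: c'_def geodesic_def)
  define a where "a = snd v / snd c"
  define b where "b = snd w / snd c'"
  have a: "cmod a = 1" "v = (fst c, a * snd c)"
    using c(1,2) v by (auto simp: a_def T1H_def upper_half_plane_def norm_divide prod_eq_iff)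
  have b: "cmod b = 1" "w = (geodesic c s, b * snd (geodesic_flow s c))"
    using c c' w
    by (auto simp: b_def T1H_def upper_half_plane_def norm_divide prod_eq_iff c'_def[symmetric])
  define \<theta> where "\<theta> = angle_diff (Arg2pi a) (Arg2pi b)"
  have "d2 v w = s + \<theta>"
    by (simp add: d2_def Let_def geodesic_0 oriented_angle_def \<theta>_def a_def b_def c'_def c_def s_def)
  moreover have "0 \<le> \<theta>" "\<theta> \<le> pi"
    using Arg2pi_ge_0[of a] Arg2pi_lt_2pi[of a] Arg2pi_ge_0[of b] Arg2pi_lt_2pi[of b]
    by (auto simp: \<theta>_def angle_diff_def)
  moreover have "\<bar>sinh (hdist (geodesic v t) (geodesic w t) / 2) -
      sinh t * cosh (s / 2) * sin (\<theta> / 2)\<bar> \<le> cosh t * sinh (s / 2)" if "0 \<le> t" for t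
  proof -
    have "cmod (a - b) / 2 = sin (\<theta> / 2)"
      using cmod_diff_eq_sin_angle_diff[OF a(1) b(1)] by (simp add: \<theta>_def)
    then show ?thesis
      using sinh_half_hdist_rotated[OF c(1) a(1) b(1) \<open>0 \<le> s\<close> that]
      unfolding a(2)[symmetric] b(2)[symmetric] by (simp only:)
  qed
  ultimately show ?thesis by (rule that)
qed

lemma tendsto_0_add_iff:
  fixes f g :: "'a \<Rightarrow> real"
  assumes "\<And>x. 0 \<le> f x" "\<And>x. 0 \<le> g x"
  shows "((\<lambda>x. f x + g x) \<longlongrightarrow> 0) F \<longleftrightarrow> (f \<longlongrightarrow> 0) F \<and> (g \<longlongrightarrow> 0) F"
proof
  assume l: "((\<lambda>x. f x + g x) \<longlongrightarrow> 0) F"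
  show "(f \<longlongrightarrow> 0) F \<and> (g \<longlongrightarrow> 0) F"
    using assms by (intro conjI tendsto_sandwich[OF _ _ tendsto_const l]) simp_all
qed (auto intro: tendsto_add_zero)

text \<open>Uniform equivalence of \<open>d1\<close> and \<open>d2\<close>, stated along an arbitrary filter: this replaces an
  \<open>\<epsilon>\<close>-\<open>\<delta>\<close> comparison and is exactly what is needed for lifts that vary with time. Given
  that \<open>s\<close> tends to \<open>0\<close>, the estimate at time \<open>1\<close> makes \<open>sinh (D / 2)\<close> and
  \<open>sinh 1 * cosh (s / 2) * sin (\<theta> / 2)\<close> asymptotically equal; inverting \<open>sinh\<close>, and \<open>sin\<close> on
  \<open>[0, pi / 2]\<close>, then gives the equivalence.\<close>

lemma tendsto_0_d1_iff_d2:
  assumes v: "\<And>x. v x \<in> T1H" and w: "\<And>x. w x \<in> T1H"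
  shows "((\<lambda>x. d1 (v x) (w x)) \<longlongrightarrow> 0) F \<longleftrightarrow> ((\<lambda>x. d2 (v x) (w x)) \<longlongrightarrow> 0) F"
proof -
  define s where "s x = hdist (fst (v x)) (fst (w x))" for x
  define D where "D x = hdist (geodesic (v x) 1) (geodesic (w x) 1)" for x
  have s0: "0 \<le> s x" and D0: "0 \<le> D x" for x
    using hdist_geodesic_nonneg[OF v w, of x 0 x] hdist_geodesic_nonneg[OF v w, of x 1 x]
    by (simp_all add: s_def D_def geodesic_0)
  have "\<exists>\<theta>. d2 (v x) (w x) = s x + \<theta> \<and> 0 \<le> \<theta> \<and> \<theta> \<le> pi \<and>
      \<bar>sinh (D x / 2) - sinh 1 * cosh (s x / 2) * sin (\<theta> / 2)\<bar> \<le> cosh 1 * sinh (s x / 2)" for x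
    using d2_angle_estimate[OF v[of x] w[of x]] unfolding s_def D_def by (metis zero_le_one)
  then obtain \<theta> where \<theta>: "\<And>x. d2 (v x) (w x) = s x + \<theta> x"
    "\<And>x. 0 \<le> \<theta> x" "\<And>x. \<theta> x \<le> pi"
    "\<And>x. \<bar>sinh (D x / 2) - sinh 1 * cosh (s x / 2) * sin (\<theta> x / 2)\<bar> \<le> cosh 1 * sinh (s x / 2)"
    by metis
  have "(D \<longlongrightarrow> 0) F \<longleftrightarrow> (\<theta> \<longlongrightarrow> 0) F" if s: "(s \<longlongrightarrow> 0) F"
  proof -
    have ch: "((\<lambda>x. cosh (s x / 2)) \<longlongrightarrow> 1) F"
      using tendsto_cosh[OF tendsto_divide[OF s tendsto_const, of 2]] by simp
    have "((\<lambda>x. cosh 1 * sinh (s x / 2)) \<longlongrightarrow> 0) F"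
      using tendsto_mult[OF tendsto_const tendsto_sinh[OF tendsto_divide[OF s tendsto_const, of 2]],
          of "cosh 1"]
      by simp
    then have diff: "((\<lambda>x. sinh (D x / 2) - sinh 1 * cosh (s x / 2) * sin (\<theta> x / 2)) \<longlongrightarrow> 0) F"
      by (rule Lim_null_comparison[rotated]) (simp add: \<theta>(4))
    have "(D \<longlongrightarrow> 0) F \<longleftrightarrow> ((\<lambda>x. sinh (D x / 2)) \<longlongrightarrow> 0) F"
    proof
      assume "(D \<longlongrightarrow> 0) F"
      then show "((\<lambda>x. sinh (D x / 2)) \<longlongrightarrow> 0) F"
        by (auto intro!: tendsto_eq_intros)
    next
      assume "((\<lambda>x. sinh (D x / 2)) \<longlongrightarrow> 0) F"
      then have "((\<lambda>x. 2 * arsinh (sinh (D x / 2))) \<longlongrightarrow> 2 * arsinh 0) F"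
        by (intro tendsto_intros)
      then show "(D \<longlongrightarrow> 0) F"
        by (simp add: arsinh_sinh_real)
    qed
    also have "\<dots> \<longleftrightarrow> ((\<lambda>x. sinh 1 * cosh (s x / 2) * sin (\<theta> x / 2)) \<longlongrightarrow> 0) F"
      using tendsto_diff[OF _ diff] tendsto_add[OF _ diff] by fastforce
    also have "\<dots> \<longleftrightarrow> ((\<lambda>x. sin (\<theta> x / 2)) \<longlongrightarrow> 0) F"
    proof
      assume l: "((\<lambda>x. sinh 1 * cosh (s x / 2) * sin (\<theta> x / 2)) \<longlongrightarrow> 0) F"
      have "((\<lambda>x. sinh 1 * cosh (s x / 2)) \<longlongrightarrow> sinh 1) F"
        using tendsto_mult[OF tendsto_const ch, of "sinh 1"] by simp
      from tendsto_divide[OF l this] show "((\<lambda>x. sin (\<theta> x / 2)) \<longlongrightarrow> 0) F"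
        by simp
    next
      assume "((\<lambda>x. sin (\<theta> x / 2)) \<longlongrightarrow> 0) F"
      from tendsto_mult[OF tendsto_mult[OF tendsto_const ch, of "sinh 1"] this]
      show "((\<lambda>x. sinh 1 * cosh (s x / 2) * sin (\<theta> x / 2)) \<longlongrightarrow> 0) F"
        by simp
    qed
    also have "\<dots> \<longleftrightarrow> (\<theta> \<longlongrightarrow> 0) F"
    proof
      assume "((\<lambda>x. sin (\<theta> x / 2)) \<longlongrightarrow> 0) F"
      then have "((\<lambda>x. 2 * arcsin (sin (\<theta> x / 2))) \<longlongrightarrow> 2 * arcsin 0) F"
        by (intro tendsto_mult[OF tendsto_const] isCont_tendsto_compose[OF isCont_arcsin]) auto
      moreover have "2 * arcsin (sin (\<theta> x / 2)) = \<theta> x" for x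
        using \<theta>(2,3)[of x] by (subst arcsin_sin) auto
      ultimately show "(\<theta> \<longlongrightarrow> 0) F" by simp
    next
      assume "(\<theta> \<longlongrightarrow> 0) F"
      then have "((\<lambda>x. \<theta> x / 2) \<longlongrightarrow> 0) F"
        by (auto intro!: tendsto_eq_intros)
      from isCont_tendsto_compose[OF isCont_sin this]
      show "((\<lambda>x. sin (\<theta> x / 2)) \<longlongrightarrow> 0) F"
        by simp
    qed
    finally show ?thesis .
  qed
  moreover have "d1 (v x) (w x) = s x + D x" for x
    by (simp add: d1_def s_def D_def geodesic_0)
  ultimately show ?thesis
    using \<theta>(1) tendsto_0_add_iff[of s D F] tendsto_0_add_iff[of s \<theta> F] s0 D0 \<theta>(2) by auto
qed


section \<open>Passage to the quotient\<close>

text \<open>The infimum over \<open>\<Gamma>\<close> is handled by near-minimisers: they turn a statement on infima into one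
  on a single choice \<open>h t\<close> of elements of \<open>\<Gamma>\<close>.\<close>

lemma tendsto_0_Inf_transfer:
  fixes f g :: "real \<Rightarrow> 'a \<Rightarrow> real"
  assumes "A \<noteq> {}" and f0: "\<And>t a. a \<in> A \<Longrightarrow> 0 \<le> f t a" and g0: "\<And>t a. a \<in> A \<Longrightarrow> 0 \<le> g t a"
    and imp: "\<And>h. range h \<subseteq> A \<Longrightarrow> ((\<lambda>t. f t (h t)) \<longlongrightarrow> 0) at_top \<Longrightarrow> ((\<lambda>t. g t (h t)) \<longlongrightarrow> 0) at_top"
    and lim: "((\<lambda>t. INF a\<in>A. f t a) \<longlongrightarrow> 0) at_top"
  shows "((\<lambda>t. INF a\<in>A. g t a) \<longlongrightarrow> 0) at_top"
proof -
  \<comment> \<open>The infimum need not be attained; any positive error that vanishes as \<open>t \<rightarrow> \<infinity>\<close> serves.\<close>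
  have "\<exists>a\<in>A. f t a < (INF a\<in>A. f t a) + exp (- t)" for t
    using cInf_lessD[of "f t ` A" "(INF a\<in>A. f t a) + exp (- t)"] \<open>A \<noteq> {}\<close> by auto
  then obtain h where h: "\<And>t. h t \<in> A" "\<And>t. f t (h t) < (INF a\<in>A. f t a) + exp (- t)"
    by metis
  have "((\<lambda>t::real. exp (- t)) \<longlongrightarrow> 0) at_top"
    using exp_at_bot filterlim_compose filterlim_uminus_at_bot_at_top by blast
  from tendsto_add[OF lim this]
  have lim_f: "((\<lambda>t. (INF a\<in>A. f t a) + exp (- t)) \<longlongrightarrow> 0) at_top" by simp
  have "((\<lambda>t. f t (h t)) \<longlongrightarrow> 0) at_top"
    using f0 h by (intro tendsto_sandwich[OF _ _ tendsto_const lim_f]) (simp_all add: less_imp_le)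
  with h(1) have lim_g: "((\<lambda>t. g t (h t)) \<longlongrightarrow> 0) at_top"
    by (intro imp) auto
  have bdd: "bdd_below (g t ` A)" for t
    using g0 by (auto intro!: bdd_belowI)
  have "0 \<le> (INF a\<in>A. g t a)" "(INF a\<in>A. g t a) \<le> g t (h t)" for t
    using \<open>A \<noteq> {}\<close> g0 by (auto intro!: cINF_greatest cINF_lower bdd h)
  then show ?thesis
    by (intro tendsto_sandwich[OF _ _ tendsto_const lim_g]) simp_all
qed

text \<open>The comparison of \<open>d1\<close> and \<open>d2\<close> concerns vectors in \<open>T1H\<close>, so the lifts that define the
  distances on the quotient must be seen to lie there.\<close>

lemma SL2R_act_T1H:
  assumes "det A = 1" "v \<in> T1H"
  shows "SL2R_act A v \<in> T1H"
proof -
  define z where "z = fst v"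
  define e where "e = of_real (A $ 2 $ 1) * z + of_real (A $ 2 $ 2)"
  have z: "0 < Im z" "cmod (snd v) = Im z"
    using assms(2) by (auto simp: T1H_def upper_half_plane_def z_def)
  have "e \<noteq> 0"
  proof
    assume "e = 0"
    then have "Im e = 0" "Re e = 0" by simp_all
    then have "A $ 2 $ 1 = 0" "A $ 2 $ 2 = 0"
      using z by (auto simp: e_def)
    then show False using assms(1) by (simp add: det_2)
  qed
  have "Im ((of_real (A $ 1 $ 1) * z + of_real (A $ 1 $ 2)) * cnj e) = Im z * det A"
    by (simp add: e_def det_2 algebra_simps)
  then have "Im ((of_real (A $ 1 $ 1) * z + of_real (A $ 1 $ 2)) / e) = Im z / (cmod e)\<^sup>2"
    by (subst complex_div_cnj) (simp add: assms(1) flip: of_real_power)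
  then show ?thesis
    using z \<open>e \<noteq> 0\<close>
    by (simp add: SL2R_act_def Let_def T1H_def upper_half_plane_def norm_divide norm_power
        flip: z_def e_def)
qed

lemma PSL2R_act_T1H:
  assumes "\<gamma> \<in> carrier PSL2R" "v \<in> T1H"
  shows "PSL2R_act \<gamma> v \<in> T1H"
proof -
  obtain A where "\<gamma> = {A, - A}" "det A = 1"
    using assms(1) by (auto simp: carrier_PSL2R)
  then show ?thesis
    using SL2R_act_T1H[OF _ assms(2)] PSL2R_act_rep[OF assms(1), of A] by simp
qed

lemma some_lift_T1H:
  assumes "subgroup \<Gamma> PSL2R" "u \<in> T1S \<Gamma>"
  shows "(SOME v. v \<in> flow_quot t u) \<in> T1H"
proof -
  obtain v where v: "v \<in> T1H" "u = orbit \<Gamma> v"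
    using assms(2) by (auto simp: T1S_def)
  have "flow_quot t u \<subseteq> T1H"
    using subgroup.subset[OF assms(1)] v
    by (auto simp: flow_quot_def orbit_def intro!: geodesic_flow_T1H PSL2R_act_T1H)
  moreover have "flow_quot t u \<noteq> {}"
    using subgroup.one_closed[OF assms(1)] v by (auto simp: flow_quot_def orbit_def)
  ultimately show ?thesis
    by (metis some_in_eq subsetD)
qed

theorem theorem7:
  fixes \<Gamma> :: "(real ^ 2 ^ 2) set set" and u :: "(complex \<times> complex) set"
  assumes "fuchsian \<Gamma>" and "torsion_free \<Gamma>"
    and "u \<in> T1S \<Gamma>"
  shows "Wss \<Gamma> d1 u = Wss \<Gamma> d2 u"
proof -
  have sub: "subgroup \<Gamma> PSL2R"
    using assms(1) by (simp add: fuchsian_def)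
  have "((\<lambda>t. dist_quot \<Gamma> d1 (flow_quot t u) (flow_quot t v)) \<longlongrightarrow> 0) at_top \<longleftrightarrow>
      ((\<lambda>t. dist_quot \<Gamma> d2 (flow_quot t u) (flow_quot t v)) \<longlongrightarrow> 0) at_top"
    if "v \<in> T1S \<Gamma>" for v
  proof -
    \<comment> \<open>The distances on the quotient are infima over the same pairs of lifts \<open>p t\<close> and \<open>q t \<gamma>\<close>
       for \<open>d1\<close> and \<open>d2\<close>, so they can be compared pair by pair.\<close>
    define p where "p t = (SOME v. v \<in> flow_quot t u)" for t
    define q where "q t \<gamma> = PSL2R_act \<gamma> (SOME w. w \<in> flow_quot t v)" for t \<gamma>
    have p: "p t \<in> T1H" for t
      unfolding p_def by (rule some_lift_T1H[OF sub assms(3)])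
    have q: "q t \<gamma> \<in> T1H" if "\<gamma> \<in> \<Gamma>" for t \<gamma>
      unfolding q_def using subgroup.subset[OF sub] that
      by (intro PSL2R_act_T1H some_lift_T1H[OF sub \<open>v \<in> T1S \<Gamma>\<close>]) auto
    have ne: "\<Gamma> \<noteq> {}"
      using subgroup.one_closed[OF sub] by auto
    have d1: "0 \<le> d1 (p t) (q t \<gamma>)" if "\<gamma> \<in> \<Gamma>" for t \<gamma>
      unfolding d1_def by (intro add_nonneg_nonneg hdist_geodesic_nonneg p q that)
    have d2: "0 \<le> d2 (p t) (q t \<gamma>)" if "\<gamma> \<in> \<Gamma>" for t \<gamma>
      using d2_angle_estimate[OF p q[OF that]] hdist_geodesic_nonneg[OF p q[OF that], of _ 0]
      by (metis add_nonneg_nonneg geodesic_0)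
    have iff: "((\<lambda>t. d1 (p t) (q t (h t))) \<longlongrightarrow> 0) at_top \<longleftrightarrow>
        ((\<lambda>t. d2 (p t) (q t (h t))) \<longlongrightarrow> 0) at_top" if "range h \<subseteq> \<Gamma>" for h
      using that by (intro tendsto_0_d1_iff_d2 p q) auto
    show ?thesis
      unfolding dist_quot_def p_def[symmetric] q_def[symmetric]
    proof
      show "((\<lambda>t. INF \<gamma>\<in>\<Gamma>. d2 (p t) (q t \<gamma>)) \<longlongrightarrow> 0) at_top"
        if "((\<lambda>t. INF \<gamma>\<in>\<Gamma>. d1 (p t) (q t \<gamma>)) \<longlongrightarrow> 0) at_top"
        by (rule tendsto_0_Inf_transfer[OF ne _ _ _ that]) (use d1 d2 iff in auto)
      show "((\<lambda>t. INF \<gamma>\<in>\<Gamma>. d1 (p t) (q t \<gamma>)) \<longlongrightarrow> 0) at_top"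
        if "((\<lambda>t. INF \<gamma>\<in>\<Gamma>. d2 (p t) (q t \<gamma>)) \<longlongrightarrow> 0) at_top"
        by (rule tendsto_0_Inf_transfer[OF ne _ _ _ that]) (use d1 d2 iff in auto)
    qed
  qed
  then show ?thesis
    by (auto simp: Wss_def)
qed

end
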